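(* Let $L$ be a nonempty set and $B\subseteq L$. For $X\subseteq L$ let $C(X,B)\colon\mathcal P(L)\to\mathcal P(L)$ be given by $C(X,B)(A)=A\cup X$ if $A\cap B\neq\emptyset$ and $C(X,B)(A)=A$ if $A\cap B=\emptyset$, and let $\mathcal C(B)=\{C(X,B): X\subseteq L\}$. Then $\mathcal C(B)\subseteq\mathcal C_f$, on $\mathcal C(B)$ the pointwise join $\vee$ coincides with $\vee_w$, and $\langle\mathcal C(B),\wedge,\vee,I,C(L,B)\rangle$ is a complete and distributive sublattice of $\langle\mathcal C_f,\wedge,\vee_w,I,U\rangle$ (with least element $I$ and greatest element $C(L,B)$). Moreover, if there exist nonempty $A,B\subseteq L$ with $A\neq L$, $B\subseteq A$ and $B\neq A$, then (for this $B$) $\langle\mathcal C(B),\wedge,\vee,I,C(L,B)\rangle$ is not a chain.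
   Context: A consequence operator on a nonempty set $L$ is a map $C\colon\mathcal P(L)\to\mathcal P(L)$ such that for all $X,Y\subseteq L$: $X\subseteq C(X)=C(C(X))\subseteq L$, and $X\subseteq Y$ implies $C(X)\subseteq C(Y)$; it is finite if $C(X)=\bigcup\{C(A): A \text{ finite}, A\subseteq X\}$ for all $X$. $\mathcal C_f$ is the set of finite consequence operators on $L$, ordered by $C_1\le C_2$ iff $C_1(X)\subseteq C_2(X)$ for all $X$. $I$ is the identity on $\mathcal P(L)$ and $U$ is the constant map $X\mapsto L$. For operators $C_1,C_2$: $(C_1\wedge C_2)(X)=C_1(X)\cap C_2(X)$; $(C_1\vee C_2)(X)=C_1(X)\cup C_2(X)$; $(C_1\vee_w C_2)(X)=\bigcap\{Y: X\subseteq Y\subseteq L,\ Y=C_1(Y)=C_2(Y)\}$. *)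

theory Defs
  imports "HOL-Algebra.Complete_Lattice" "HOL-Library.FuncSet"
begin

text \<open>
  Maps from the power set of \<open>L\<close> to itself are elements of \<open>Pow L \<rightarrow>\<^sub>E Pow L\<close>, so that HOL equality
  is equality of maps on \<open>Pow L\<close>; accordingly all operators below are restricted to \<open>Pow L\<close>.
\<close>

definition consequence_operator :: "'a set \<Rightarrow> ('a set \<Rightarrow> 'a set) \<Rightarrow> bool" where
  "consequence_operator L C \<longleftrightarrow>
     C \<in> Pow L \<rightarrow>\<^sub>E Pow L \<and>
     (\<forall>X. X \<subseteq> L \<longrightarrow> X \<subseteq> C X \<and> C X = C (C X) \<and> C X \<subseteq> L) \<and>
     (\<forall>X Y. X \<subseteq> L \<and> Y \<subseteq> L \<and> X \<subseteq> Y \<longrightarrow> C X \<subseteq> C Y)"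

definition finite_consequence_operator :: "'a set \<Rightarrow> ('a set \<Rightarrow> 'a set) \<Rightarrow> bool" where
  "finite_consequence_operator L C \<longleftrightarrow>
     consequence_operator L C \<and>
     (\<forall>X. X \<subseteq> L \<longrightarrow> C X = \<Union> {C A |A. finite A \<and> A \<subseteq> X})"

definition finite_cons_ops :: "'a set \<Rightarrow> ('a set \<Rightarrow> 'a set) set" where
  "finite_cons_ops L = {C. finite_consequence_operator L C}"

definition op_id :: "'a set \<Rightarrow> 'a set \<Rightarrow> 'a set" where
  "op_id L = (\<lambda>X\<in>Pow L. X)"

definition op_full :: "'a set \<Rightarrow> 'a set \<Rightarrow> 'a set" where
  "op_full L = (\<lambda>X\<in>Pow L. L)"

definition op_meet :: "'a set \<Rightarrow> ('a set \<Rightarrow> 'a set) \<Rightarrow> ('a set \<Rightarrow> 'a set) \<Rightarrow> ('a set \<Rightarrow> 'a set)" where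
  "op_meet L C1 C2 = (\<lambda>X\<in>Pow L. C1 X \<inter> C2 X)"

definition op_join :: "'a set \<Rightarrow> ('a set \<Rightarrow> 'a set) \<Rightarrow> ('a set \<Rightarrow> 'a set) \<Rightarrow> ('a set \<Rightarrow> 'a set)" where
  "op_join L C1 C2 = (\<lambda>X\<in>Pow L. C1 X \<union> C2 X)"

definition op_join_w :: "'a set \<Rightarrow> ('a set \<Rightarrow> 'a set) \<Rightarrow> ('a set \<Rightarrow> 'a set) \<Rightarrow> ('a set \<Rightarrow> 'a set)" where
  "op_join_w L C1 C2 = (\<lambda>X\<in>Pow L. \<Inter> {Y. X \<subseteq> Y \<and> Y \<subseteq> L \<and> Y = C1 Y \<and> Y = C2 Y})"

definition op_order :: "'a set \<Rightarrow> ('a set \<Rightarrow> 'a set) set \<Rightarrow> ('a set \<Rightarrow> 'a set) gorder" where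
  "op_order L K = \<lparr>carrier = K, eq = (=), le = (\<lambda>C1 C2. \<forall>X. X \<subseteq> L \<longrightarrow> C1 X \<subseteq> C2 X)\<rparr>"

definition adjoin_op :: "'a set \<Rightarrow> 'a set \<Rightarrow> 'a set \<Rightarrow> ('a set \<Rightarrow> 'a set)" where
  "adjoin_op L X B = (\<lambda>A\<in>Pow L. if A \<inter> B \<noteq> {} then A \<union> X else A)"

definition adjoin_ops :: "'a set \<Rightarrow> 'a set \<Rightarrow> ('a set \<Rightarrow> 'a set) set" where
  "adjoin_ops L B = {adjoin_op L X B |X. X \<subseteq> L}"

text \<open>
  \<open>P\<close> is a bounded lattice whose order-theoretic meet, join, least and greatest element are the
  given \<open>m\<close>, \<open>j\<close>, \<open>b\<close>, \<open>t\<close>: the rendering of a structure \<open>\<langle>carrier P, m, j, b, t\<rangle>\<close>.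
\<close>

definition bounded_lattice_structure ::
  "'c gorder \<Rightarrow> ('c \<Rightarrow> 'c \<Rightarrow> 'c) \<Rightarrow> ('c \<Rightarrow> 'c \<Rightarrow> 'c) \<Rightarrow> 'c \<Rightarrow> 'c \<Rightarrow> bool" where
  "bounded_lattice_structure P m j b t \<longleftrightarrow>
     bounded_lattice P \<and>
     (\<forall>x\<in>carrier P. \<forall>y\<in>carrier P. x \<sqinter>\<^bsub>P\<^esub> y = m x y \<and> x \<squnion>\<^bsub>P\<^esub> y = j x y) \<and>
     \<bottom>\<^bsub>P\<^esub> = b \<and> \<top>\<^bsub>P\<^esub> = t"

definition distributive_lattice :: "'c gorder \<Rightarrow> bool" where
  "distributive_lattice P \<longleftrightarrow>
     lattice P \<and>
     (\<forall>x\<in>carrier P. \<forall>y\<in>carrier P. \<forall>z\<in>carrier P.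
        x \<sqinter>\<^bsub>P\<^esub> (y \<squnion>\<^bsub>P\<^esub> z) = (x \<sqinter>\<^bsub>P\<^esub> y) \<squnion>\<^bsub>P\<^esub> (x \<sqinter>\<^bsub>P\<^esub> z) \<and>
        x \<squnion>\<^bsub>P\<^esub> (y \<sqinter>\<^bsub>P\<^esub> z) = (x \<squnion>\<^bsub>P\<^esub> y) \<sqinter>\<^bsub>P\<^esub> (x \<squnion>\<^bsub>P\<^esub> z))"

definition sublattice :: "'c gorder \<Rightarrow> 'c set \<Rightarrow> bool" where
  "sublattice P K \<longleftrightarrow>
     lattice P \<and> K \<subseteq> carrier P \<and> K \<noteq> {} \<and>
     (\<forall>x\<in>K. \<forall>y\<in>K. x \<sqinter>\<^bsub>P\<^esub> y \<in> K \<and> x \<squnion>\<^bsub>P\<^esub> y \<in> K)"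

text \<open>
  Completeness of a sublattice is taken in the strong sense: \<open>K\<close> with the induced order is a complete
  lattice, and suprema and infima of nonempty subsets of \<open>K\<close> exist in \<open>P\<close> and belong to \<open>K\<close>. The empty
  set is exempt from the second clause since the greatest elements of \<open>K\<close> and \<open>P\<close> may differ.
\<close>

definition complete_sublattice :: "'c gorder \<Rightarrow> 'c set \<Rightarrow> bool" where
  "complete_sublattice P K \<longleftrightarrow>
     sublattice P K \<and>
     complete_lattice (P\<lparr>carrier := K\<rparr>) \<and>
     (\<forall>S. S \<subseteq> K \<and> S \<noteq> {} \<longrightarrow> (\<exists>s\<in>K. is_lub P s S) \<and> (\<exists>i\<in>K. is_glb P i S))"

end

theory Submission
  imports Defs
begin

text \<open>
  For \<open>T \<noteq> {}\<close>, the operators \<open>C(X,B)\<close> satisfy \<open>C(\<Union>T,B) = (\<Union>X\<in>T. C(X,B))\<close> and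
  \<open>C(\<Inter>T,B) = (\<Inter>X\<in>T. C(X,B))\<close> pointwise. Nonempty suprema and infima are thus pointwise in every
  poset of operators containing \<open>C(B)\<close>; uniqueness of the supremum gives \<open>\<or> = \<or>\<^sub>w\<close>, and
  distributivity is that of sets. That \<open>C\<^sub>1 \<or>\<^sub>w C\<^sub>2\<close> is finite holds because a directed union of
  sets closed under a finite operator is closed. For \<open>a \<in> A - B\<close> and \<open>l \<in> L - A\<close>, the operators
  \<open>C({a},B)\<close> and \<open>C({l},B)\<close> are incomparable, as their values at \<open>B\<close> show.
\<close>

section \<open>Bounded lattices from explicit binary bounds\<close>

lemma bounded_lattice_structureI:
  assumes po: "partial_order P"
    and meet: "\<And>x y. x \<in> carrier P \<Longrightarrow> y \<in> carrier P \<Longrightarrow> is_glb P (m x y) {x, y}"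
    and join: "\<And>x y. x \<in> carrier P \<Longrightarrow> y \<in> carrier P \<Longrightarrow> is_lub P (j x y) {x, y}"
    and bot: "least P b (carrier P)"
    and top: "greatest P t (carrier P)"
  shows "bounded_lattice_structure P m j b t"
proof -
  interpret partial_order P by (fact po)
  have "bounded_lattice P"
    by unfold_locales (use meet join bot top in blast)+
  \<comment> \<open>The operations of the order are picked by description as some greatest or least
    bound; antisymmetry makes such a bound unique, so they agree with the given ones.\<close>
  moreover have "x \<sqinter>\<^bsub>P\<^esub> y = m x y" if "x \<in> carrier P" "y \<in> carrier P" for x y
    unfolding meet_def inf_def using meet[OF that] by (blast intro: greatest_unique)
  moreover have "x \<squnion>\<^bsub>P\<^esub> y = j x y" if "x \<in> carrier P" "y \<in> carrier P" for x y
    unfolding join_def sup_def using join[OF that] by (blast intro: least_unique)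
  moreover have "\<bottom>\<^bsub>P\<^esub> = b"
    unfolding bottom_def using bot by (blast intro: least_unique)
  moreover have "\<top>\<^bsub>P\<^esub> = t"
    unfolding top_def using top by (blast intro: greatest_unique)
  ultimately show ?thesis
    by (simp add: bounded_lattice_structure_def)
qed

section \<open>The pointwise order on operators\<close>

lemma carrier_op_order [simp]: "carrier (op_order L K) = K"
  by (simp add: op_order_def)

lemma le_op_order [simp]: "C1 \<sqsubseteq>\<^bsub>op_order L K\<^esub> C2 \<longleftrightarrow> (\<forall>X. X \<subseteq> L \<longrightarrow> C1 X \<subseteq> C2 X)"
  by (simp add: op_order_def)

lemma op_order_carrier_update [simp]: "op_order L K\<lparr>carrier := K'\<rparr> = op_order L K'"
  by (simp add: op_order_def)

text \<open>Only antisymmetry has content: the order compares values on \<open>Pow L\<close>, and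
  extensional functions that agree there are equal.\<close>

lemma partial_order_op_order:
  assumes "K \<subseteq> Pow L \<rightarrow>\<^sub>E Pow L"
  shows "partial_order (op_order L K)"
proof
  fix C1 C2
  assume le: "C1 \<sqsubseteq>\<^bsub>op_order L K\<^esub> C2" "C2 \<sqsubseteq>\<^bsub>op_order L K\<^esub> C1"
    and "C1 \<in> carrier (op_order L K)" "C2 \<in> carrier (op_order L K)"
  then have "C1 \<in> Pow L \<rightarrow>\<^sub>E Pow L" "C2 \<in> Pow L \<rightarrow>\<^sub>E Pow L"
    using assms by (simp_all add: subset_iff)
  then have "C1 = C2"
    by (rule PiE_ext) (use le in auto)
  then show "C1 .=\<^bsub>op_order L K\<^esub> C2"
    by (simp add: op_order_def)
qed (auto simp: op_order_def)

text \<open>A pointwise union may fall outside \<open>K\<close>, hence the membership assumption.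
  The carrier is left arbitrary so that the result serves both \<open>adjoin_ops L B\<close> and
  \<open>finite_cons_ops L\<close>.\<close>

lemma is_lub_op_order:
  assumes "S \<subseteq> K" "s \<in> K" and "\<And>A. A \<subseteq> L \<Longrightarrow> s A = (\<Union>C\<in>S. C A)"
  shows "is_lub (op_order L K) s S"
proof (rule least_UpperI)
  fix D
  assume "D \<in> Upper (op_order L K) S"
  then have "C A \<subseteq> D A" if "C \<in> S" "A \<subseteq> L" for C A
    using that assms(1) Upper_memD[of D "op_order L K" S C] by auto
  then show "s \<sqsubseteq>\<^bsub>op_order L K\<^esub> D"
    by (simp add: assms(3) UN_subset_iff)
qed (use assms in auto)

lemma is_glb_op_order:
  assumes "S \<subseteq> K" "i \<in> K" and "\<And>A. A \<subseteq> L \<Longrightarrow> i A = (\<Inter>C\<in>S. C A)"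
  shows "is_glb (op_order L K) i S"
proof (rule greatest_LowerI)
  fix D
  assume "D \<in> Lower (op_order L K) S"
  then have "D A \<subseteq> C A" if "C \<in> S" "A \<subseteq> L" for C A
    using that assms(1) Lower_memD[of D "op_order L K" S C] by auto
  then show "D \<sqsubseteq>\<^bsub>op_order L K\<^esub> i"
    by (simp add: assms(3) le_INF_iff)
qed (use assms in auto)

section \<open>Finite consequence operators and their meets\<close>

lemma finite_cons_opsI:
  assumes "C \<in> Pow L \<rightarrow>\<^sub>E Pow L"
    and "\<And>X. X \<subseteq> L \<Longrightarrow> X \<subseteq> C X"
    and "\<And>X. X \<subseteq> L \<Longrightarrow> C (C X) \<subseteq> C X"
    and "\<And>X Y. Y \<subseteq> L \<Longrightarrow> X \<subseteq> Y \<Longrightarrow> C X \<subseteq> C Y"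
    and "\<And>X x. X \<subseteq> L \<Longrightarrow> x \<in> C X \<Longrightarrow> \<exists>A. finite A \<and> A \<subseteq> X \<and> x \<in> C A"
  shows "C \<in> finite_cons_ops L"
proof -
  have sub: "C X \<subseteq> L" if "X \<subseteq> L" for X
    using PiE_mem[OF assms(1), of X] that by simp
  \<comment> \<open>One inclusion is assumed; inflation at \<open>C X\<close> gives the other. In
    the same way monotonicity gives the second half of finiteness below.\<close>
  have idem: "C X = C (C X)" if "X \<subseteq> L" for X
    using assms(2)[OF sub[OF that]] assms(3)[OF that] by blast
  have fin: "C X = \<Union> {C A |A. finite A \<and> A \<subseteq> X}" if "X \<subseteq> L" for X
  proof
    show "C X \<subseteq> \<Union> {C A |A. finite A \<and> A \<subseteq> X}"
      using assms(5)[OF that] by fast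
    show "\<Union> {C A |A. finite A \<and> A \<subseteq> X} \<subseteq> C X"
      using assms(4)[OF that] by auto
  qed
  show ?thesis
    unfolding finite_cons_ops_def finite_consequence_operator_def consequence_operator_def
    by (intro CollectI conjI allI impI; (elim conjE)?; rule assms(1,2,4) sub idem fin; assumption)
qed

context
  fixes L C
  assumes C: "C \<in> finite_cons_ops L"
begin

lemma finite_cons_ops_consequence_operator: "consequence_operator L C"
  using C by (simp add: finite_cons_ops_def finite_consequence_operator_def)

lemma finite_cons_ops_PiE: "C \<in> Pow L \<rightarrow>\<^sub>E Pow L"
  using finite_cons_ops_consequence_operator by (simp add: consequence_operator_def)

lemma finite_cons_ops_inflationary: "X \<subseteq> L \<Longrightarrow> X \<subseteq> C X"
  and finite_cons_ops_idem: "X \<subseteq> L \<Longrightarrow> C (C X) = C X"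
  and finite_cons_ops_closed: "X \<subseteq> L \<Longrightarrow> C X \<subseteq> L"
proof -
  assume "X \<subseteq> L"
  then have "X \<subseteq> C X \<and> C X = C (C X) \<and> C X \<subseteq> L"
    using finite_cons_ops_consequence_operator unfolding consequence_operator_def by iprover
  then show "X \<subseteq> C X" "C (C X) = C X" "C X \<subseteq> L"
    by simp_all
qed

lemma finite_cons_ops_mono: "Y \<subseteq> L \<Longrightarrow> X \<subseteq> Y \<Longrightarrow> C X \<subseteq> C Y"
  using finite_cons_ops_consequence_operator by (simp add: consequence_operator_def)

lemma finite_cons_ops_finite:
  assumes "X \<subseteq> L" "x \<in> C X"
  obtains A where "finite A" "A \<subseteq> X" "x \<in> C A"
proof -
  have "C X = \<Union> {C A |A. finite A \<and> A \<subseteq> X}"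
    using C assms(1) by (simp add: finite_cons_ops_def finite_consequence_operator_def)
  then show thesis
    using assms(2) that by blast
qed

end

lemma finite_cons_ops_subset_PiE: "finite_cons_ops L \<subseteq> Pow L \<rightarrow>\<^sub>E Pow L"
  using finite_cons_ops_PiE by blast

lemma op_id_in_finite_cons_ops: "op_id L \<in> finite_cons_ops L"
proof (rule finite_cons_opsI)
  fix X x
  assume "X \<subseteq> L" "x \<in> op_id L X"
  then show "\<exists>A. finite A \<and> A \<subseteq> X \<and> x \<in> op_id L A"
    by (intro exI[of _ "{x}"]) (auto simp: op_id_def)
qed (auto simp: op_id_def)

lemma op_full_in_finite_cons_ops: "op_full L \<in> finite_cons_ops L"
proof (rule finite_cons_opsI)
  fix X x
  assume "X \<subseteq> L" "x \<in> op_full L X"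
  then show "\<exists>A. finite A \<and> A \<subseteq> X \<and> x \<in> op_full L A"
    \<comment> \<open>The value at the empty set is already \<open>L\<close>.\<close>
    by (intro exI[of _ "{}"]) (auto simp: op_full_def)
qed (auto simp: op_full_def)

text \<open>Idempotence holds since \<open>C1 X \<inter> C2 X\<close> lies below both closed sets
  \<open>C1 X\<close> and \<open>C2 X\<close>. For finiteness, each operator supplies a finite
  witness, and by monotonicity their union works for both.\<close>

lemma op_meet_in_finite_cons_ops:
  assumes C1: "C1 \<in> finite_cons_ops L" and C2: "C2 \<in> finite_cons_ops L"
  shows "op_meet L C1 C2 \<in> finite_cons_ops L"
proof (rule finite_cons_opsI)
  note closed = finite_cons_ops_closed[OF C1] finite_cons_ops_closed[OF C2]
  note mono = finite_cons_ops_mono[OF C1] finite_cons_ops_mono[OF C2]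
  show "op_meet L C1 C2 \<in> Pow L \<rightarrow>\<^sub>E Pow L"
    using closed by (auto simp: op_meet_def)
  fix X :: "'a set"
  assume X: "X \<subseteq> L"
  show "X \<subseteq> op_meet L C1 C2 X"
    using X finite_cons_ops_inflationary[OF C1 X] finite_cons_ops_inflationary[OF C2 X]
    by (simp add: op_meet_def)
  have "C1 (C1 X \<inter> C2 X) \<subseteq> C1 (C1 X)" "C2 (C1 X \<inter> C2 X) \<subseteq> C2 (C2 X)"
    by (rule mono[OF closed(1)[OF X] Int_lower1], rule mono[OF closed(2)[OF X] Int_lower2])
  moreover have "C1 X \<inter> C2 X \<subseteq> L"
    using closed(1)[OF X] by blast
  ultimately show "op_meet L C1 C2 (op_meet L C1 C2 X) \<subseteq> op_meet L C1 C2 X"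
    using X finite_cons_ops_idem[OF C1 X] finite_cons_ops_idem[OF C2 X]
    by (auto simp: op_meet_def)
  fix x
  assume "x \<in> op_meet L C1 C2 X"
  then have "x \<in> C1 X" "x \<in> C2 X"
    using X by (auto simp: op_meet_def)
  then obtain A1 A2 where A: "finite A1" "A1 \<subseteq> X" "x \<in> C1 A1" "finite A2" "A2 \<subseteq> X" "x \<in> C2 A2"
    using finite_cons_ops_finite[OF C1 X] finite_cons_ops_finite[OF C2 X] by metis
  then have "A1 \<union> A2 \<subseteq> L"
    using X by blast
  then have "x \<in> op_meet L C1 C2 (A1 \<union> A2)"
    using A mono(1)[of "A1 \<union> A2" A1] mono(2)[of "A1 \<union> A2" A2] by (auto simp: op_meet_def)
  then show "\<exists>A. finite A \<and> A \<subseteq> X \<and> x \<in> op_meet L C1 C2 A"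
    using A by (intro exI[of _ "A1 \<union> A2"]) auto
next
  fix X Y :: "'a set"
  assume "Y \<subseteq> L" "X \<subseteq> Y"
  then show "op_meet L C1 C2 X \<subseteq> op_meet L C1 C2 Y"
    using finite_cons_ops_mono[OF C1, of Y X] finite_cons_ops_mono[OF C2, of Y X]
    by (auto simp: op_meet_def)
qed

lemma is_glb_op_meet:
  assumes "C1 \<in> K" "C2 \<in> K" "op_meet L C1 C2 \<in> K"
  shows "is_glb (op_order L K) (op_meet L C1 C2) {C1, C2}"
  using assms by (intro is_glb_op_order) (auto simp: op_meet_def)

lemma is_lub_op_join:
  assumes "C1 \<in> K" "C2 \<in> K" "op_join L C1 C2 \<in> K"
  shows "is_lub (op_order L K) (op_join L C1 C2) {C1, C2}"
  using assms by (intro is_lub_op_order) (auto simp: op_join_def)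

section \<open>The weak join as supremum in the finite operators\<close>

lemma finite_cons_ops_fixed_Inter:
  assumes C: "C \<in> finite_cons_ops L"
    and F: "F \<noteq> {}" "\<And>Y. Y \<in> F \<Longrightarrow> Y \<subseteq> L \<and> C Y = Y"
  shows "C (\<Inter>F) = \<Inter>F"
proof
  \<comment> \<open>Nonemptiness of \<open>F\<close> keeps \<open>\<Inter>F\<close> inside
    \<open>L\<close>; an empty intersection would be \<open>UNIV\<close>.\<close>
  show "\<Inter>F \<subseteq> C (\<Inter>F)"
    using F by (intro finite_cons_ops_inflationary[OF C]) blast
  have "C (\<Inter>F) \<subseteq> Y" if "Y \<in> F" for Y
    using finite_cons_ops_mono[OF C, of Y "\<Inter>F"] F(2)[OF that] that by auto
  then show "C (\<Inter>F) \<subseteq> \<Inter>F"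
    by blast
qed

text \<open>Finiteness places a point of \<open>C (\<Union>F)\<close> in \<open>C G\<close> for a
  finite \<open>G\<close>; directedness puts \<open>G\<close> inside a single closed
  \<open>Y\<close>, so \<open>C G \<subseteq> C Y = Y\<close>. With \<open>G = {}\<close> the
  assumption \<open>directed\<close> also says that \<open>F\<close> is nonempty, which matters
  because \<open>C {}\<close> may be nonempty.\<close>

lemma finite_cons_ops_fixed_directed_Union:
  assumes C: "C \<in> finite_cons_ops L"
    and F: "\<And>Y. Y \<in> F \<Longrightarrow> Y \<subseteq> L \<and> C Y = Y"
    and directed: "\<And>G. finite G \<Longrightarrow> G \<subseteq> \<Union>F \<Longrightarrow> \<exists>Y\<in>F. G \<subseteq> Y"
  shows "C (\<Union>F) = \<Union>F"
proof
  have L: "\<Union>F \<subseteq> L"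
    using F by blast
  then show "\<Union>F \<subseteq> C (\<Union>F)"
    by (rule finite_cons_ops_inflationary[OF C])
  show "C (\<Union>F) \<subseteq> \<Union>F"
  proof
    fix x
    assume "x \<in> C (\<Union>F)"
    then obtain G where G: "finite G" "G \<subseteq> \<Union>F" "x \<in> C G"
      by (rule finite_cons_ops_finite[OF C L])
    then obtain Y where "Y \<in> F" "G \<subseteq> Y"
      using directed by blast
    then show "x \<in> \<Union>F"
      using F[of Y] G(3) finite_cons_ops_mono[OF C, of Y G] by blast
  qed
qed

lemma op_join_w_least:
  assumes "X \<subseteq> Y" "Y \<subseteq> L" "C1 Y = Y" "C2 Y = Y"
  shows "op_join_w L C1 C2 X \<subseteq> Y"
  using assms by (auto simp: op_join_w_def)

context
  fixes L C1 C2
  assumes C1: "C1 \<in> finite_cons_ops L" and C2: "C2 \<in> finite_cons_ops L"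
begin

text \<open>Makes \<open>L\<close> a member of the family intersected in \<open>op_join_w\<close>,
  so that the family is never empty for \<open>X \<subseteq> L\<close>.\<close>

lemma finite_cons_ops_fixed_full: "C1 L = L" "C2 L = L"
  using finite_cons_ops_inflationary[OF C1, of L] finite_cons_ops_closed[OF C1, of L]
    finite_cons_ops_inflationary[OF C2, of L] finite_cons_ops_closed[OF C2, of L] by auto

lemma op_join_w_closed: "X \<subseteq> L \<Longrightarrow> op_join_w L C1 C2 X \<subseteq> L"
  by (rule op_join_w_least) (simp_all add: finite_cons_ops_fixed_full)

lemma op_join_w_inflationary: "X \<subseteq> L \<Longrightarrow> X \<subseteq> op_join_w L C1 C2 X"
  by (auto simp: op_join_w_def)

lemma op_join_w_fixed:
  assumes "X \<subseteq> L"
  shows "C1 (op_join_w L C1 C2 X) = op_join_w L C1 C2 X" "C2 (op_join_w L C1 C2 X) = op_join_w L C1 C2 X"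
proof -
  let ?F = "{Y. X \<subseteq> Y \<and> Y \<subseteq> L \<and> Y = C1 Y \<and> Y = C2 Y}"
  have "L \<in> ?F"
    using assms by (simp add: finite_cons_ops_fixed_full)
  then have "C1 (\<Inter>?F) = \<Inter>?F" "C2 (\<Inter>?F) = \<Inter>?F"
    by (blast intro!: finite_cons_ops_fixed_Inter[OF C1] finite_cons_ops_fixed_Inter[OF C2])+
  then show "C1 (op_join_w L C1 C2 X) = op_join_w L C1 C2 X" "C2 (op_join_w L C1 C2 X) = op_join_w L C1 C2 X"
    using assms by (simp_all add: op_join_w_def)
qed

text \<open>The value at \<open>Y\<close> is itself a common closed set containing \<open>X\<close>,
  hence contains the least one.\<close>

lemma op_join_w_mono:
  assumes "Y \<subseteq> L" "X \<subseteq> Y"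
  shows "op_join_w L C1 C2 X \<subseteq> op_join_w L C1 C2 Y"
  using assms op_join_w_inflationary[of Y]
  by (intro op_join_w_least op_join_w_closed op_join_w_fixed) auto

text \<open>The values at finite subsets of \<open>X\<close> form a directed family of sets closed
  under both operators. Its union is therefore closed under both and contains \<open>X\<close>, so
  it contains the least such set, which is the value at \<open>X\<close>.\<close>

lemma op_join_w_finite:
  assumes X: "X \<subseteq> L" and x: "x \<in> op_join_w L C1 C2 X"
  shows "\<exists>A. finite A \<and> A \<subseteq> X \<and> x \<in> op_join_w L C1 C2 A"
proof -
  let ?D = "op_join_w L C1 C2"
  let ?F = "?D ` {A. finite A \<and> A \<subseteq> X}"
  have F: "Y \<subseteq> L \<and> C1 Y = Y" "Y \<subseteq> L \<and> C2 Y = Y" if "Y \<in> ?F" for Y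
  proof -
    from that obtain A where "Y = ?D A" "A \<subseteq> L"
      using X by blast
    then show "Y \<subseteq> L \<and> C1 Y = Y" "Y \<subseteq> L \<and> C2 Y = Y"
      using op_join_w_closed[of A] op_join_w_fixed[of A] by simp_all
  qed
  have directed: "\<exists>Y\<in>?F. G \<subseteq> Y" if "finite G" "G \<subseteq> \<Union>?F" for G
  proof -
    have "\<forall>g\<in>G. \<exists>A. finite A \<and> A \<subseteq> X \<and> g \<in> ?D A"
      using that(2) by blast
    then obtain f where f: "\<And>g. g \<in> G \<Longrightarrow> finite (f g) \<and> f g \<subseteq> X \<and> g \<in> ?D (f g)"
      by metis
    \<comment> \<open>The union of the chosen finite sets is one finite subset of \<open>X\<close>
      whose value, by monotonicity, contains all of \<open>G\<close>.\<close>
    have "finite (\<Union>g\<in>G. f g)" and sub: "(\<Union>g\<in>G. f g) \<subseteq> X"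
      using f that(1) by blast+
    moreover have "G \<subseteq> ?D (\<Union>g\<in>G. f g)"
    proof
      fix g
      assume g: "g \<in> G"
      have "?D (f g) \<subseteq> ?D (\<Union>g\<in>G. f g)"
        using X sub g by (intro op_join_w_mono) auto
      then show "g \<in> ?D (\<Union>g\<in>G. f g)"
        using f[OF g] by blast
    qed
    ultimately show ?thesis
      by blast
  qed
  have "X \<subseteq> \<Union>?F"
  proof
    fix y
    assume "y \<in> X"
    then have "y \<in> ?D {y}" "{y} \<subseteq> X"
      using X op_join_w_inflationary[of "{y}"] by auto
    then show "y \<in> \<Union>?F"
      by blast
  qed
  moreover have "\<Union>?F \<subseteq> L"
    using F by blast
  moreover have "C1 (\<Union>?F) = \<Union>?F"
    using F(1) directed by (rule finite_cons_ops_fixed_directed_Union[OF C1])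
  moreover have "C2 (\<Union>?F) = \<Union>?F"
    using F(2) directed by (rule finite_cons_ops_fixed_directed_Union[OF C2])
  ultimately have "?D X \<subseteq> \<Union>?F"
    by (rule op_join_w_least)
  then show ?thesis
    using x by blast
qed

lemma op_join_w_in_finite_cons_ops: "op_join_w L C1 C2 \<in> finite_cons_ops L"
proof (rule finite_cons_opsI)
  show "op_join_w L C1 C2 \<in> Pow L \<rightarrow>\<^sub>E Pow L"
    using op_join_w_closed by (intro PiE_I) (auto simp: op_join_w_def)
  \<comment> \<open>A value is a common closed set containing itself, so it is a candidate in its
    own intersection.\<close>
  show "op_join_w L C1 C2 (op_join_w L C1 C2 X) \<subseteq> op_join_w L C1 C2 X" if "X \<subseteq> L" for X
    by (rule op_join_w_least[OF subset_refl])
      (use that in \<open>simp_all add: op_join_w_closed op_join_w_fixed\<close>)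
qed (fact op_join_w_inflationary op_join_w_mono op_join_w_finite)+

text \<open>Upper bound: \<open>C1 X\<close> lies in the value of \<open>C1\<close> at the weak join
  of \<open>X\<close>, which that join leaves fixed; likewise for \<open>C2\<close>. Least: if
  \<open>D\<close> is an upper bound, then \<open>C1 (D X) \<subseteq> D (D X) = D X\<close> and
  likewise for \<open>C2\<close>, so \<open>D X\<close> is among the sets intersected.\<close>

lemma is_lub_op_join_w: "is_lub (op_order L (finite_cons_ops L)) (op_join_w L C1 C2) {C1, C2}"
proof (rule least_UpperI)
  fix C
  assume "C \<in> {C1, C2}"
  moreover have "C1 X \<subseteq> op_join_w L C1 C2 X" "C2 X \<subseteq> op_join_w L C1 C2 X" if "X \<subseteq> L" for X
    using finite_cons_ops_mono[OF C1 op_join_w_closed op_join_w_inflationary, OF that that]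
      finite_cons_ops_mono[OF C2 op_join_w_closed op_join_w_inflationary, OF that that]
    by (simp_all add: op_join_w_fixed that)
  ultimately show "C \<sqsubseteq>\<^bsub>op_order L (finite_cons_ops L)\<^esub> op_join_w L C1 C2"
    by auto
next
  fix D
  assume "D \<in> Upper (op_order L (finite_cons_ops L)) {C1, C2}"
  then have D: "D \<in> finite_cons_ops L"
    and le: "\<And>X. X \<subseteq> L \<Longrightarrow> C1 X \<subseteq> D X" "\<And>X. X \<subseteq> L \<Longrightarrow> C2 X \<subseteq> D X"
    using C1 C2 by (auto simp: Upper_def)
  have "op_join_w L C1 C2 X \<subseteq> D X" if "X \<subseteq> L" for X
  proof -
    have DX: "D X \<subseteq> L" "D (D X) = D X"
      using D that by (simp_all add: finite_cons_ops_closed finite_cons_ops_idem)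
    then have "C1 (D X) = D X" "C2 (D X) = D X"
      using le[of "D X"] finite_cons_ops_inflationary[OF C1, of "D X"]
        finite_cons_ops_inflationary[OF C2, of "D X"] by auto
    with DX(1) show ?thesis
      using finite_cons_ops_inflationary[OF D that] by (intro op_join_w_least)
  qed
  then show "op_join_w L C1 C2 \<sqsubseteq>\<^bsub>op_order L (finite_cons_ops L)\<^esub> D"
    by simp
qed (use C1 C2 op_join_w_in_finite_cons_ops in auto)

end

lemma bounded_lattice_structure_finite_cons_ops:
  "bounded_lattice_structure (op_order L (finite_cons_ops L))
     (op_meet L) (op_join_w L) (op_id L) (op_full L)"
proof (rule bounded_lattice_structureI)
  show "least (op_order L (finite_cons_ops L)) (op_id L) (carrier (op_order L (finite_cons_ops L)))"
    by (simp add: least_def op_id_in_finite_cons_ops)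
      (simp add: op_id_def finite_cons_ops_inflationary)
  show "greatest (op_order L (finite_cons_ops L)) (op_full L) (carrier (op_order L (finite_cons_ops L)))"
    by (simp add: greatest_def op_full_in_finite_cons_ops)
      (simp add: op_full_def finite_cons_ops_closed)
qed (simp_all add: partial_order_op_order finite_cons_ops_subset_PiE is_glb_op_meet
    op_meet_in_finite_cons_ops is_lub_op_join_w)

section \<open>The operators \<open>adjoin_op L X B\<close>\<close>

lemma adjoin_op_in_finite_cons_ops:
  assumes X: "X \<subseteq> L"
  shows "adjoin_op L X B \<in> finite_cons_ops L"
proof (rule finite_cons_opsI)
  fix A x
  assume A: "A \<subseteq> L" and x: "x \<in> adjoin_op L X B A"
  show "\<exists>F. finite F \<and> F \<subseteq> A \<and> x \<in> adjoin_op L X B F"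
  proof (cases "x \<in> A")
    case True
    then show ?thesis
      using A by (intro exI[of _ "{x}"]) (auto simp: adjoin_op_def)
  next
    case False
    then obtain b where "b \<in> A \<inter> B" "x \<in> X"
      using A x by (auto simp: adjoin_op_def split: if_splits)
    \<comment> \<open>A point added from \<open>X\<close> is triggered by any single
      \<open>b\<close> in \<open>A \<inter> B\<close>, so \<open>{b}\<close> is a finite
      witness.\<close>
    then show ?thesis
      using A by (intro exI[of _ "{b}"]) (auto simp: adjoin_op_def)
  qed
qed (use X in \<open>auto simp: adjoin_op_def split: if_splits\<close>)

lemma adjoin_op_in_adjoin_ops: "X \<subseteq> L \<Longrightarrow> adjoin_op L X B \<in> adjoin_ops L B"
  by (auto simp: adjoin_ops_def)

lemma adjoin_ops_subset: "adjoin_ops L B \<subseteq> finite_cons_ops L"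
  by (auto simp: adjoin_ops_def adjoin_op_in_finite_cons_ops)

lemma op_id_in_adjoin_ops: "op_id L \<in> adjoin_ops L B"
proof -
  have "op_id L = adjoin_op L {} B"
    by (auto simp: op_id_def adjoin_op_def restrict_def fun_eq_iff)
  then show ?thesis
    by (simp add: adjoin_op_in_adjoin_ops)
qed

text \<open>The test \<open>A \<inter> B \<noteq> {}\<close> involves neither \<open>X\<close> nor
  \<open>Y\<close>, so both operators take the same branch, and \<open>(A \<union> X) \<inter> (A
  \<union> Y) = A \<union> (X \<inter> Y)\<close>. The join is analogous.\<close>

lemma op_meet_adjoin_op: "op_meet L (adjoin_op L X B) (adjoin_op L Y B) = adjoin_op L (X \<inter> Y) B"
  by (auto simp: op_meet_def adjoin_op_def restrict_def fun_eq_iff)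

lemma op_join_adjoin_op: "op_join L (adjoin_op L X B) (adjoin_op L Y B) = adjoin_op L (X \<union> Y) B"
  by (auto simp: op_join_def adjoin_op_def restrict_def fun_eq_iff)

lemma op_meet_in_adjoin_ops:
  "C1 \<in> adjoin_ops L B \<Longrightarrow> C2 \<in> adjoin_ops L B \<Longrightarrow> op_meet L C1 C2 \<in> adjoin_ops L B"
  unfolding adjoin_ops_def by (auto simp: op_meet_adjoin_op)

lemma op_join_in_adjoin_ops:
  "C1 \<in> adjoin_ops L B \<Longrightarrow> C2 \<in> adjoin_ops L B \<Longrightarrow> op_join L C1 C2 \<in> adjoin_ops L B"
  unfolding adjoin_ops_def by (auto simp: op_join_adjoin_op)

lemma op_join_eq_op_join_w:
  assumes "C1 \<in> adjoin_ops L B" "C2 \<in> adjoin_ops L B"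
  shows "op_join L C1 C2 = op_join_w L C1 C2"
proof -
  have "is_lub (op_order L (finite_cons_ops L)) (op_join L C1 C2) {C1, C2}"
    using assms op_join_in_adjoin_ops[OF assms] adjoin_ops_subset
    by (intro is_lub_op_join) blast+
  moreover have "is_lub (op_order L (finite_cons_ops L)) (op_join_w L C1 C2) {C1, C2}"
    using assms adjoin_ops_subset by (intro is_lub_op_join_w) blast+
  ultimately show ?thesis
    by (rule partial_order.least_unique[OF partial_order_op_order[OF finite_cons_ops_subset_PiE]])
qed

text \<open>Turns a family of operators into a family of sets, whose union or intersection can then
  be formed. The parameter is not determined by the operator (for \<open>B = {}\<close> every one of
  them is \<open>op_id L\<close>), so some set \<open>T\<close> of parameters is fixed.\<close>

lemma adjoin_ops_familyE:
  assumes "S \<subseteq> adjoin_ops L B"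
  obtains T where "T \<subseteq> Pow L" "S = (\<lambda>X. adjoin_op L X B) ` T"
proof -
  have "adjoin_ops L B = (\<lambda>X. adjoin_op L X B) ` Pow L"
    by (auto simp: adjoin_ops_def)
  then show thesis
    using assms that by (metis subset_imageE)
qed

text \<open>Nonemptiness of \<open>S\<close> brings \<open>A\<close> itself into the pointwise union
  at \<open>A\<close>; over an empty family that union would be empty, while
  \<open>adjoin_op L {} B A = A\<close>.\<close>

lemma adjoin_ops_is_lub:
  assumes "S \<subseteq> adjoin_ops L B" "S \<noteq> {}" "adjoin_ops L B \<subseteq> K"
  shows "\<exists>s\<in>adjoin_ops L B. is_lub (op_order L K) s S"
proof -
  from assms(1) obtain T where T: "T \<subseteq> Pow L" "S = (\<lambda>X. adjoin_op L X B) ` T"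
    by (rule adjoin_ops_familyE)
  have mem: "adjoin_op L (\<Union>T) B \<in> adjoin_ops L B"
    using T by (intro adjoin_op_in_adjoin_ops) blast
  moreover have "is_lub (op_order L K) (adjoin_op L (\<Union>T) B) S"
    using assms T mem by (intro is_lub_op_order) (auto simp: adjoin_op_def)
  ultimately show ?thesis
    by blast
qed

text \<open>Here nonemptiness gives \<open>\<Inter>T \<subseteq> L\<close>. Below, \<open>K\<close>
  is \<open>adjoin_ops L B\<close> for completeness of the induced order and
  \<open>finite_cons_ops L\<close> for the infima required of a complete sublattice.\<close>

lemma adjoin_ops_is_glb:
  assumes "S \<subseteq> adjoin_ops L B" "S \<noteq> {}" "adjoin_ops L B \<subseteq> K"
  shows "\<exists>i\<in>adjoin_ops L B. is_glb (op_order L K) i S"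
proof -
  from assms(1) obtain T where T: "T \<subseteq> Pow L" "S = (\<lambda>X. adjoin_op L X B) ` T"
    by (rule adjoin_ops_familyE)
  have mem: "adjoin_op L (\<Inter>T) B \<in> adjoin_ops L B"
    using T assms(2) by (intro adjoin_op_in_adjoin_ops) blast
  moreover have "is_glb (op_order L K) (adjoin_op L (\<Inter>T) B) S"
    using assms T mem by (intro is_glb_op_order) (auto simp: adjoin_op_def)
  ultimately show ?thesis
    by blast
qed

section \<open>Lattice structure of \<open>adjoin_ops L B\<close>\<close>

lemma partial_order_adjoin_ops: "partial_order (op_order L (adjoin_ops L B))"
  using adjoin_ops_subset finite_cons_ops_subset_PiE by (intro partial_order_op_order) blast

lemma greatest_adjoin_ops: "greatest (op_order L (adjoin_ops L B)) (adjoin_op L L B) (adjoin_ops L B)"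
  by (auto simp: greatest_def adjoin_ops_def adjoin_op_def split: if_splits)

lemma bounded_lattice_structure_adjoin_ops:
  "bounded_lattice_structure (op_order L (adjoin_ops L B))
     (op_meet L) (op_join L) (op_id L) (adjoin_op L L B)"
proof (rule bounded_lattice_structureI)
  have "X \<subseteq> C X" if "C \<in> adjoin_ops L B" "X \<subseteq> L" for C X
    using that adjoin_ops_subset finite_cons_ops_inflationary by blast
  then show "least (op_order L (adjoin_ops L B)) (op_id L) (carrier (op_order L (adjoin_ops L B)))"
    using op_id_in_adjoin_ops by (auto simp: least_def op_id_def)
qed (simp_all add: partial_order_adjoin_ops greatest_adjoin_ops is_glb_op_meet is_lub_op_join
    op_meet_in_adjoin_ops op_join_in_adjoin_ops)

text \<open>A greatest element and infima of nonempty sets suffice: a supremum is the infimum of the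
  upper bounds, among which the greatest element always occurs.\<close>

lemma complete_lattice_adjoin_ops: "complete_lattice (op_order L (adjoin_ops L B))"
proof (rule partial_order.complete_lattice_criterion1[OF partial_order_adjoin_ops])
  show "\<exists>g. greatest (op_order L (adjoin_ops L B)) g (carrier (op_order L (adjoin_ops L B)))"
    using greatest_adjoin_ops by auto
  show "\<exists>i. is_glb (op_order L (adjoin_ops L B)) i S"
    if "S \<subseteq> carrier (op_order L (adjoin_ops L B))" "S \<noteq> {}" for S
    using adjoin_ops_is_glb[of S L B "adjoin_ops L B"] that by auto
qed

text \<open>On \<open>adjoin_ops L B\<close> the join of the large lattice is
  \<open>op_join_w L\<close>, hence \<open>op_join L\<close>, so closure under the pointwise
  operations gives the sublattice property.\<close>

lemma complete_sublattice_adjoin_ops: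
  "complete_sublattice (op_order L (finite_cons_ops L)) (adjoin_ops L B)"
proof -
  have "lattice (op_order L (finite_cons_ops L))"
    and "\<And>C1 C2. C1 \<in> adjoin_ops L B \<Longrightarrow> C2 \<in> adjoin_ops L B \<Longrightarrow>
      C1 \<sqinter>\<^bsub>op_order L (finite_cons_ops L)\<^esub> C2 = op_meet L C1 C2 \<and>
      C1 \<squnion>\<^bsub>op_order L (finite_cons_ops L)\<^esub> C2 = op_join L C1 C2"
    using bounded_lattice_structure_finite_cons_ops[of L] adjoin_ops_subset[of L B]
    by (auto simp: bounded_lattice_structure_def op_join_eq_op_join_w bounded_lattice_def)
  then have "sublattice (op_order L (finite_cons_ops L)) (adjoin_ops L B)"
    using adjoin_ops_subset[of L B] op_id_in_adjoin_ops[of L B]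
    by (auto simp: sublattice_def op_meet_in_adjoin_ops op_join_in_adjoin_ops)
  then show ?thesis
    by (simp add: complete_sublattice_def complete_lattice_adjoin_ops adjoin_ops_is_lub
        adjoin_ops_is_glb adjoin_ops_subset)
qed

lemma distributive_lattice_adjoin_ops: "distributive_lattice (op_order L (adjoin_ops L B))"
proof -
  have "lattice (op_order L (adjoin_ops L B))"
    and "\<And>C1 C2. C1 \<in> adjoin_ops L B \<Longrightarrow> C2 \<in> adjoin_ops L B \<Longrightarrow>
      C1 \<sqinter>\<^bsub>op_order L (adjoin_ops L B)\<^esub> C2 = op_meet L C1 C2"
    "\<And>C1 C2. C1 \<in> adjoin_ops L B \<Longrightarrow> C2 \<in> adjoin_ops L B \<Longrightarrow>
      C1 \<squnion>\<^bsub>op_order L (adjoin_ops L B)\<^esub> C2 = op_join L C1 C2"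
    using bounded_lattice_structure_adjoin_ops[of L B]
    by (auto simp: bounded_lattice_structure_def bounded_lattice_def)
  \<comment> \<open>Both laws are set identities at each point of \<open>Pow L\<close>; membership
    in \<open>adjoin_ops L B\<close> enters in rewriting the order-theoretic meet and join to these
    operations.\<close>
  moreover have "op_meet L C1 (op_join L C2 C3) = op_join L (op_meet L C1 C2) (op_meet L C1 C3)"
    "op_join L C1 (op_meet L C2 C3) = op_meet L (op_join L C1 C2) (op_join L C1 C3)" for C1 C2 C3
    by (auto simp: op_meet_def op_join_def restrict_def fun_eq_iff)
  ultimately show ?thesis
    by (simp add: distributive_lattice_def op_meet_in_adjoin_ops op_join_in_adjoin_ops)
qed

lemma not_total_order_adjoin_ops:
  assumes "B \<noteq> {}" "B \<subset> A" "A \<subset> L"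
  shows "\<not> total_order (op_order L (adjoin_ops L B))"
proof
  assume total: "total_order (op_order L (adjoin_ops L B))"
  from assms(2,3) have "B \<subseteq> L"
    by blast
  from assms(2,3) obtain a l where al: "a \<in> A - B" "l \<in> L - A"
    by blast
  then have "{a} \<subseteq> L" "{l} \<subseteq> L"
    using assms(3) by blast+
  then have "adjoin_op L {a} B \<in> adjoin_ops L B" "adjoin_op L {l} B \<in> adjoin_ops L B"
    by (simp_all only: adjoin_op_in_adjoin_ops)
  then have "adjoin_op L {a} B \<sqsubseteq>\<^bsub>op_order L (adjoin_ops L B)\<^esub> adjoin_op L {l} B
    \<or> adjoin_op L {l} B \<sqsubseteq>\<^bsub>op_order L (adjoin_ops L B)\<^esub> adjoin_op L {a} B"
    by (intro total_order.total_order_total[OF total]) simp_all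
  \<comment> \<open>At the nonempty \<open>B\<close> the adjoining branch is taken, with values
    \<open>B \<union> {a}\<close> and \<open>B \<union> {l}\<close>. Neither contains the other,
    since \<open>a\<close> and \<open>l\<close> are distinct points outside
    \<open>B\<close>.\<close>
  then have "adjoin_op L {a} B B \<subseteq> adjoin_op L {l} B B \<or> adjoin_op L {l} B B \<subseteq> adjoin_op L {a} B B"
    unfolding le_op_order using \<open>B \<subseteq> L\<close> by iprover
  moreover have "adjoin_op L X B B = B \<union> X" for X
    using \<open>B \<subseteq> L\<close> assms(1) by (simp add: adjoin_op_def)
  ultimately show False
    using al assms(2) by auto
qed

theorem theorem3p1:
  fixes L B :: "'a set"
  assumes "L \<noteq> {}" and "B \<subseteq> L"
  shows "adjoin_ops L B \<subseteq> finite_cons_ops L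
    \<and> (\<forall>C1\<in>adjoin_ops L B. \<forall>C2\<in>adjoin_ops L B. op_join L C1 C2 = op_join_w L C1 C2)
    \<and> bounded_lattice_structure (op_order L (finite_cons_ops L))
        (op_meet L) (op_join_w L) (op_id L) (op_full L)
    \<and> bounded_lattice_structure (op_order L (adjoin_ops L B))
        (op_meet L) (op_join L) (op_id L) (adjoin_op L L B)
    \<and> complete_sublattice (op_order L (finite_cons_ops L)) (adjoin_ops L B)
    \<and> distributive_lattice (op_order L (adjoin_ops L B))
    \<and> ((\<exists>A. A \<noteq> {} \<and> B \<noteq> {} \<and> A \<subseteq> L \<and> A \<noteq> L \<and> B \<subseteq> A \<and> B \<noteq> A)
        \<longrightarrow> \<not> total_order (op_order L (adjoin_ops L B)))"
proof (intro conjI ballI impI)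
  assume "\<exists>A. A \<noteq> {} \<and> B \<noteq> {} \<and> A \<subseteq> L \<and> A \<noteq> L \<and> B \<subseteq> A \<and> B \<noteq> A"
  then obtain A where "B \<noteq> {}" "B \<subset> A" "A \<subset> L"
    by auto
  then show "\<not> total_order (op_order L (adjoin_ops L B))"
    by (rule not_total_order_adjoin_ops)
qed (simp_all add: adjoin_ops_subset op_join_eq_op_join_w bounded_lattice_structure_finite_cons_ops
    bounded_lattice_structure_adjoin_ops complete_sublattice_adjoin_ops
    distributive_lattice_adjoin_ops)

end
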